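(* Let $\epsilon\in(0,1/2)$, and let $n$ be sufficiently large, satisfying the parameter assumptions listed in the context. Let $\mathrm{Enc}$ be the explicit encoder (modified sequence replacement technique) described in the context. Then $\mathrm{Enc}$ is correct, i.e. $\mathrm{Enc}(x)\in\mathrm{Bal}_{\mathrm{RC}}(n;\epsilon)$ for all $x\in\{0,1\}^{n^2-1}$.
   Context: The weight of a binary sequence is its number of ones. A binary sequence of length $r$ is $\delta$-balanced if its weight lies in $[(1/2-\delta)r,(1/2+\delta)r]$ (balanced if $\delta=0$). $\mathrm{Bal}_{\mathrm{RC}}(n;\epsilon)$ is the set of all $n\times n$ binary arrays in which every row and every column is $\epsilon$-balanced. $\Phi(A)$ is the binary sequence of length $n^2$ obtained by reading the $n\times n$ array $A$ row by row. $\log$ is to base 2, and an overline denotes bitwise complement. Parameters: $m=n^2$, $\epsilon'=\epsilon/2$, $\ell=\lceil\alpha\ln m\rceil$ for some fixed $\alpha\ge 1/\epsilon'^2$, $k=\ell-3-2\log n$. Assumptions: $\log n$ is an integer; $n=\ell s$ for some integer $s$; $n\epsilon\ge 2$; $n^2\ge(8/\epsilon^2)\ln n$; $\ell<n/2$. Let $F(\ell,\epsilon')$ be the set of binary sequences of length $\ell$ that are not $\epsilon'$-balanced, and let $\Psi:F(\ell,\epsilon')\to\{0,1\}^k$ be a one-to-one map (known to exist for these parameters). For a sequence $c=c_1c_2\ldots$, a subsequence $c_ic_{i+1}\ldots c_{i+\ell-1}$ that is not $\epsilon'$-balanced is called r-forbidden, and a subsequence $c_jc_{j+n}\ldots c_{j+(\ell-1)n}$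 that is not $\epsilon'$-balanced is called c-forbidden. The encoder $\mathrm{Enc}$, on input $x\in\{0,1\}^{n^2-1}$: Initial phase. Set $c=0x\in\{0,1\}^{n^2}$. If $c$ has no r-forbidden and no c-forbidden subsequence, output $\Phi^{-1}(c)$. Otherwise go to the replacement phase. Replacement phase. Let the first forbidden subsequence of the current word $c$ start at position $i$, let $\pi$ be the binary representation of $i$ of length $2\log n$, and let $y=c_ic_{i+1}\ldots c_{i+\ell-1}$, $z=c_ic_{i+n}\ldots c_{i+(\ell-1)n}$. If $y$ is r-forbidden, remove $y$ from $c$ and prepend $11\,\pi\,\Psi(y)$ to $c$. If $y$ is not r-forbidden and $z$ is c-forbidden, remove $z$ from $c$ and prepend $10\,\pi\,\Psi(z)$ to $c$. (Each replacement shortens $c$ by one bit.) Repeat until the current word contains no r-forbidden and no c-forbidden subsequence, or has length $n/2$; then go to the extension phase. Extension phase. Let $N_0<n^2$ be the length of the current word $c$, and write $N_0=nq+r$ with $0\le q<n$, $0\le r<n$; filling $c$ into an $n\times n$ array row by row fills $q$ rows and $r$ bits of row $q+1$. Row extension (completing row $q+1$): if $N_0=n/2$, the first row is $c\,\overline{c}$. If $N_0>n/2$, let $w$ be the suffix of $c$ of length $\ell$, let $j$ be the smallest integer such that $c\,w^j$ has length greater than $(q+1)n$, and take the prefix of $c\,w^j$ of length $(q+1)n$. Array extension (completing the remaining $n-q-1$ rows of the resulting $(q+1)\times n$ array): if $q+1=n$, output the array. If $q+1\le n/2$, fill the next $q+1$ rows with the complement of the current array, then fill the remaining rows alternately with $(01)^{n/2}$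 and $(10)^{n/2}$, and output. Otherwise ($n/2<q+1<n$), for each column $i$ let $y_i$ be the sequence of its first $q$ bits (omitting the bit in row $q+1$) and $w_i$ the suffix of $y_i$ of length $\ell$; append $w_i$ repeatedly to column $i$ (below row $q+1$) until the column is full, and output. *)

theory Defs
  imports Complex_Main "HOL-Library.While_Combinator"
begin

text \<open>Binary sequences are boolean lists, and an array is the list of its rows.
  List positions start at 0, so position \<open>p\<close> below is the position \<open>i = p + 1\<close> of a
  sequence \<open>c\<^sub>1 c\<^sub>2 \<dots>\<close>.\<close>

definition weight :: "bool list \<Rightarrow> nat" where
  "weight u = count_list u True"

definition balanced :: "real \<Rightarrow> bool list \<Rightarrow> bool" where
  "balanced \<delta> u \<longleftrightarrow>
     (1/2 - \<delta>) * real (length u) \<le> real (weight u) \<and>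
     real (weight u) \<le> (1/2 + \<delta>) * real (length u)"

definition column :: "bool list list \<Rightarrow> nat \<Rightarrow> bool list" where
  "column A j = map (\<lambda>r. r ! j) A"

definition square_arrays :: "nat \<Rightarrow> bool list list set" where
  "square_arrays n = {A. length A = n \<and> (\<forall>r\<in>set A. length r = n)}"

definition Bal_RC :: "nat \<Rightarrow> real \<Rightarrow> bool list list set" where
  "Bal_RC n \<epsilon> =
     {A \<in> square_arrays n. (\<forall>i<n. balanced \<epsilon> (A ! i)) \<and> (\<forall>j<n. balanced \<epsilon> (column A j))}"

definition Phi :: "bool list list \<Rightarrow> bool list" where
  "Phi A = concat A"

definition fill_rows :: "nat \<Rightarrow> bool list \<Rightarrow> bool list list" where
  "fill_rows n c = map (\<lambda>i. take n (drop (i * n) c)) [0..<length c div n]"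

text \<open>On \<open>n \<times> n\<close> arrays, \<open>fill_rows n\<close> is the inverse of \<open>Phi\<close>.\<close>

lemma fill_rows_Phi:
  assumes "A \<in> square_arrays n"
  shows "fill_rows n (Phi A) = A"
proof -
  have "length (concat B) = length B * n \<and>
        (\<forall>i<length B. take n (drop (i * n) (concat B)) = B ! i)"
    if "\<forall>r\<in>set B. length r = n" for B :: "bool list list"
    using that
  proof (induction B)
    case (Cons a B)
    then show ?case by (auto simp: nth_Cons split: nat.splits)
  qed simp
  with assms show ?thesis
    by (cases "n = 0") (auto simp: fill_rows_def Phi_def square_arrays_def intro!: nth_equalityI)
qed

lemma Phi_fill_rows:
  assumes "n dvd length c" "n > 0"
  shows "Phi (fill_rows n c) = c"
proof -
  have "concat (map (\<lambda>i. take n (drop (i * n) c)) [0..<m]) = take (m * n) c" for m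
    by (induction m) (simp_all add: take_add[of "_ * n" n] add.commute[of n])
  with assms show ?thesis by (simp add: fill_rows_def Phi_def)
qed

lemma fill_rows_square:
  assumes "length c = n\<^sup>2"
  shows "fill_rows n c \<in> square_arrays n"
proof -
  have "n \<le> n * n - i * n" if "i < n" for i
    using mult_le_mono1[of 1 "n - i" n] that by (simp add: diff_mult_distrib)
  with assms show ?thesis
    by (auto simp: fill_rows_def square_arrays_def power2_eq_square)
qed

definition unbalanced :: "nat \<Rightarrow> real \<Rightarrow> bool list set" where
  "unbalanced l \<delta> = {u. length u = l \<and> \<not> balanced \<delta> u}"

text \<open>The subsequence of \<open>c\<close> of length \<open>l\<close> that starts at \<open>p\<close> and has stride \<open>d\<close>, for
  \<open>d = 1\<close> (blocks) and \<open>d = n\<close> (column segments). It exists only if it ends inside \<open>c\<close>.\<close>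

definition strided :: "nat \<Rightarrow> nat \<Rightarrow> nat \<Rightarrow> bool list \<Rightarrow> bool list" where
  "strided d l p c = map (\<lambda>t. c ! (p + t * d)) [0..<l]"

definition remove_strided :: "nat \<Rightarrow> nat \<Rightarrow> nat \<Rightarrow> bool list \<Rightarrow> bool list" where
  "remove_strided d l p c = nths c (- {p + t * d |t. t < l})"

definition forbidden_at :: "nat \<Rightarrow> nat \<Rightarrow> real \<Rightarrow> bool list \<Rightarrow> nat \<Rightarrow> bool" where
  "forbidden_at d l \<delta> c p \<longleftrightarrow>
     p + (l - 1) * d < length c \<and> \<not> balanced \<delta> (strided d l p c)"

abbreviation (input) r_forbidden_at :: "nat \<Rightarrow> real \<Rightarrow> bool list \<Rightarrow> nat \<Rightarrow> bool" where
  "r_forbidden_at \<equiv> forbidden_at 1"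

abbreviation (input) c_forbidden_at :: "nat \<Rightarrow> nat \<Rightarrow> real \<Rightarrow> bool list \<Rightarrow> nat \<Rightarrow> bool" where
  "c_forbidden_at n \<equiv> forbidden_at n"

definition has_forbidden :: "nat \<Rightarrow> nat \<Rightarrow> real \<Rightarrow> bool list \<Rightarrow> bool" where
  "has_forbidden n l \<delta> c \<longleftrightarrow> (\<exists>p. r_forbidden_at l \<delta> c p \<or> c_forbidden_at n l \<delta> c p)"

text \<open>Binary representation with \<open>b\<close> bits, most significant bit first.\<close>

definition bin_rep :: "nat \<Rightarrow> nat \<Rightarrow> bool list" where
  "bin_rep b i = rev (map (bit i) [0..<b])"

text \<open>The floor is exact here, as the encoder is used only when \<open>log 2 n\<close> is an integer.\<close>

definition pos_bits :: "nat \<Rightarrow> nat" where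
  "pos_bits n = nat \<lfloor>2 * log 2 (real n)\<rfloor>"

definition replace_step ::
    "nat \<Rightarrow> nat \<Rightarrow> real \<Rightarrow> (bool list \<Rightarrow> bool list) \<Rightarrow> bool list \<Rightarrow> bool list" where
  "replace_step n l \<delta> \<Psi> c =
     (let p = (LEAST p. r_forbidden_at l \<delta> c p \<or> c_forbidden_at n l \<delta> c p);
          \<pi> = bin_rep (pos_bits n) (p + 1);
          y = strided 1 l p c;
          z = strided n l p c
      in if r_forbidden_at l \<delta> c p
         then [True, True] @ \<pi> @ \<Psi> y @ remove_strided 1 l p c
         else [True, False] @ \<pi> @ \<Psi> z @ remove_strided n l p c)"

definition replacement_phase ::
    "nat \<Rightarrow> nat \<Rightarrow> real \<Rightarrow> (bool list \<Rightarrow> bool list) \<Rightarrow> bool list \<Rightarrow> bool list" where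
  "replacement_phase n l \<delta> \<Psi> =
     while (\<lambda>c. has_forbidden n l \<delta> c \<and> length c \<noteq> n div 2) (replace_step n l \<delta> \<Psi>)"

text \<open>Every replacement shortens the word by one bit, so that the loop terminates.\<close>

lemma length_remove_strided:
  assumes "p + (l - 1) * d < length c" "d > 0"
  shows "length (remove_strided d l p c) = length c - l"
proof -
  have eq: "{p + t * d |t. t < l} = (\<lambda>t. p + t * d) ` {..<l}" by auto
  have sub: "{p + t * d |t. t < l} \<subseteq> {..<length c}"
  proof clarsimp
    fix t assume "t < l"
    then have "t * d \<le> (l - 1) * d" by (intro mult_le_mono1) simp
    with assms show "p + t * d < length c" by linarith
  qed
  have "card {p + t * d |t. t < l} = l"
    unfolding eq using \<open>d > 0\<close> by (subst card_image) (auto simp: inj_on_def)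
  moreover have "{i. i < length c \<and> i \<in> - {p + t * d |t. t < l}} =
      {..<length c} - {p + t * d |t. t < l}"
    by auto
  ultimately show ?thesis
    using sub unfolding remove_strided_def length_nths
    by (simp add: card_Diff_subset finite_subset)
qed

lemma length_replace_step:
  assumes "has_forbidden n l \<delta> c" "n > 0"
    and k: "l = k + 3 + pos_bits n"
    and \<Psi>: "\<Psi> ` unbalanced l \<delta> \<subseteq> {u. length u = k}"
  shows "length (replace_step n l \<delta> \<Psi> c) = length c - 1"
proof -
  define p where "p = (LEAST p. r_forbidden_at l \<delta> c p \<or> c_forbidden_at n l \<delta> c p)"
  have p: "r_forbidden_at l \<delta> c p \<or> c_forbidden_at n l \<delta> c p"
    unfolding p_def using assms(1) unfolding has_forbidden_def by (rule LeastI_ex)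
  have len: "length (b1 # b2 # bin_rep (pos_bits n) (p + 1) @ \<Psi> (strided d l p c) @
      remove_strided d l p c) = length c - 1"
    if "forbidden_at d l \<delta> c p" "d > 0" for d b1 b2
  proof -
    have "strided d l p c \<in> unbalanced l \<delta>"
      using that by (simp add: unbalanced_def forbidden_at_def strided_def)
    then have "length (\<Psi> (strided d l p c)) = k" using \<Psi> by auto
    moreover have "length (remove_strided d l p c) = length c - l"
      using that by (intro length_remove_strided) (auto simp: forbidden_at_def)
    moreover have "l - 1 \<le> (l - 1) * d" using \<open>d > 0\<close> by simp
    then have "l \<le> length c"
      using that(1) unfolding forbidden_at_def by linarith
    ultimately show ?thesis using k by (simp add: bin_rep_def)
  qed
  show ?thesis
    using p len[of 1 True True] len[of n True False] \<open>n > 0\<close>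
    unfolding replace_step_def p_def[symmetric] Let_def by (auto split: if_split)
qed

lemma replacement_phase_terminates:
  assumes "n > 0" "l = k + 3 + pos_bits n"
    and "\<Psi> ` unbalanced l \<delta> \<subseteq> {u. length u = k}"
  shows "\<exists>c'. while_option (\<lambda>c. has_forbidden n l \<delta> c \<and> length c \<noteq> n div 2)
    (replace_step n l \<delta> \<Psi>) c = Some c'"
proof (rule measure_while_option_Some[where P = "\<lambda>_. True" and f = length, THEN exE])
  fix c assume b: "has_forbidden n l \<delta> c \<and> length c \<noteq> n div 2"
  then have "length c > 0" by (auto simp: has_forbidden_def forbidden_at_def)
  with b assms show "True \<and> length (replace_step n l \<delta> \<Psi> c) < length c"
    by (subst length_replace_step) auto
qed auto

definition rep :: "nat \<Rightarrow> bool list \<Rightarrow> bool list" where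
  "rep j w = concat (replicate j w)"

definition suffix_of_length :: "nat \<Rightarrow> bool list \<Rightarrow> bool list" where
  "suffix_of_length l u = drop (length u - l) u"

definition row_extension :: "nat \<Rightarrow> nat \<Rightarrow> bool list \<Rightarrow> bool list list" where
  "row_extension n l c =
     (if length c = n div 2 then [c @ map Not c]
      else let q = length c div n;
               w = suffix_of_length l c;
               j = (LEAST j. length (c @ rep j w) > (q + 1) * n)
           in fill_rows n (take ((q + 1) * n) (c @ rep j w)))"

text \<open>Row \<open>q + 1\<close> is skipped when the suffixes are taken; the copies of the suffix are placed
  below it, the last copy being cut off at the bottom of the array.\<close>

definition column_extension :: "nat \<Rightarrow> nat \<Rightarrow> nat \<Rightarrow> bool list list \<Rightarrow> bool list list" where
  "column_extension n l q B =
     (let w = (\<lambda>i. suffix_of_length l (take q (column B i)))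
      in B @ map (\<lambda>t. map (\<lambda>i. w i ! (t mod l)) [0..<n]) [0..<n - (q + 1)])"

definition array_extension :: "nat \<Rightarrow> nat \<Rightarrow> nat \<Rightarrow> bool list list \<Rightarrow> bool list list" where
  "array_extension n l q B =
     (if q + 1 = n then B
      else if q + 1 \<le> n div 2 then
        B @ map (map Not) B @
        map (\<lambda>t. if even t then rep (n div 2) [False, True] else rep (n div 2) [True, False])
          [0..<n - 2 * (q + 1)]
      else column_extension n l q B)"

definition extension_phase :: "nat \<Rightarrow> nat \<Rightarrow> bool list \<Rightarrow> bool list list" where
  "extension_phase n l c = array_extension n l (length c div n) (row_extension n l c)"

definition Enc ::
    "nat \<Rightarrow> nat \<Rightarrow> real \<Rightarrow> (bool list \<Rightarrow> bool list) \<Rightarrow> bool list \<Rightarrow> bool list list" where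
  "Enc n l \<delta> \<Psi> x =
     (let c = False # x
      in if \<not> has_forbidden n l \<delta> c then fill_rows n c
         else extension_phase n l (replacement_phase n l \<delta> \<Psi> c))"

end

theory Submission
  imports Defs "HOL-Real_Asymp.Real_Asymp"
begin

text \<open>Every row and every column of the output is either exactly balanced by symmetry (a word next
  to its complement, alternating bits), or a concatenation of two words that are cut into
  \<open>\<epsilon>/2\<close>-balanced blocks of length \<open>l\<close>, up to one further bit and an incomplete last block each.
  These leftovers change the weight by at most \<open>l + 1/2\<close>, and \<open>l\<close> is only logarithmic in \<open>n\<close>, so
  for large \<open>n\<close> the gap between \<open>\<epsilon>/2\<close> and \<open>\<epsilon>\<close> absorbs them. Once the number of
  complete rows reaches \<open>n/2\<close>, the suffix of each column is again one of the segments of the word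
  that are known to be balanced, and the appended rows are copies of earlier rows.\<close>

subsection \<open>Excess weight\<close>

text \<open>Signed deviation of the weight from half the length. It is additive under concatenation
  and changes sign under complement, so the balance of a composite word reduces to the triangle
  inequality.\<close>

definition excess :: "bool list \<Rightarrow> real" where
  "excess u = real (weight u) - real (length u) / 2"

lemma balanced_iff_excess: "balanced \<delta> u \<longleftrightarrow> \<bar>excess u\<bar> \<le> \<delta> * real (length u)"
  by (auto simp: balanced_def excess_def abs_le_iff algebra_simps)

lemma excess_Nil [simp]: "excess [] = 0"
  by (simp add: excess_def weight_def)

lemma excess_append [simp]: "excess (u @ v) = excess u + excess v"
  by (simp add: excess_def weight_def field_simps)

lemma excess_Cons: "excess (b # u) = (if b then 1/2 else -1/2) + excess u"
  by (simp add: excess_def weight_def field_simps)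

lemma excess_map_Not [simp]: "excess (map Not u) = - excess u"
  by (induction u) (simp_all add: excess_Cons)

lemma abs_excess_le: "\<bar>excess u\<bar> \<le> real (length u) / 2"
  by (induction u) (auto simp: excess_Cons abs_le_iff field_simps)

text \<open>The parity \<open>b\<close> covers both phases of the pattern, as columns of even and of
  odd index meet the alternating rows in opposite phase.\<close>

lemma excess_alternating: "excess (map (\<lambda>t. even t \<noteq> b) [0..<2 * m]) = 0"
  by (induction m) (simp_all add: excess_Cons)

lemma excess_rep [simp]: "excess (rep m u) = real m * excess u"
  by (induction m) (simp_all add: rep_def algebra_simps)

lemma length_rep [simp]: "length (rep m u) = m * length u"
  by (induction m) (simp_all add: rep_def)

lemma nth_rep: "i < m * length u \<Longrightarrow> rep m u ! i = u ! (i mod length u)"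
proof (induction m arbitrary: i)
  case (Suc m)
  then show ?case by (auto simp: rep_def nth_append le_mod_geq)
qed simp

subsection \<open>Words with balanced blocks\<close>

text \<open>Only blocks aligned at multiples of \<open>l\<close> are constrained, which is what
  summing excesses over a partition uses. A final remainder shorter than \<open>l\<close> is
  free.\<close>

definition balanced_blocks :: "nat \<Rightarrow> real \<Rightarrow> bool list \<Rightarrow> bool" where
  "balanced_blocks l \<delta> u \<longleftrightarrow>
     (\<forall>b. b * l + l \<le> length u \<longrightarrow> balanced \<delta> (take l (drop (b * l) u)))"

text \<open>Peeling off one complete block at a time costs at most \<open>\<delta> * l\<close> each;
  the remainder has fewer than \<open>l\<close> bits and so costs at most
  \<open>l / 2\<close>.\<close>

lemma abs_excess_balanced_blocks:
  assumes "balanced_blocks l \<delta> u" "0 < l" "0 \<le> \<delta>"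
  shows "\<bar>excess u\<bar> \<le> \<delta> * real (length u) + real l / 2"
  using assms
proof (induction "length u" arbitrary: u rule: less_induct)
  case less
  show ?case
  proof (cases "length u < l")
    case True
    moreover have "0 \<le> \<delta> * real (length u)" using less.prems by simp
    ultimately show ?thesis using abs_excess_le[of u] by (simp add: field_simps)
  next
    case False
    have "balanced_blocks l \<delta> (drop l u)"
      unfolding balanced_blocks_def
    proof (intro allI impI)
      fix b assume "b * l + l \<le> length (drop l u)"
      then have "Suc b * l + l \<le> length u" using False by simp
      then show "balanced \<delta> (take l (drop (b * l) (drop l u)))"
        using less.prems(1) unfolding balanced_blocks_def by (simp add: add.commute) (metis mult_Suc)
    qed
    then have "\<bar>excess (drop l u)\<bar> \<le> \<delta> * real (length u - l) + real l / 2"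
      using less.hyps[of "drop l u"] less.prems False by simp
    moreover have "\<bar>excess (take l u)\<bar> \<le> \<delta> * real l"
      using less.prems(1) False unfolding balanced_blocks_def balanced_iff_excess
      by (auto dest: spec[of _ 0])
    moreover have "excess u = excess (take l u) + excess (drop l u)"
      by (metis append_take_drop_id excess_append)
    moreover have "\<delta> * real (length u - l) = \<delta> * real (length u) - \<delta> * real l"
      using False by (simp add: of_nat_diff algebra_simps)
    ultimately show ?thesis by linarith
  qed
qed

text \<open>The incomplete blocks of \<open>u\<close> and \<open>v\<close> cost \<open>l / 2\<close>
  each and the bit \<open>a\<close> costs \<open>1/2\<close>, which together is the
  \<open>l + 1/2\<close> of the last assumption. In a column, \<open>a\<close> is the bit in row
  \<open>q + 1\<close>; in a row it is empty.\<close>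

lemma balanced_two_parts:
  assumes "balanced_blocks l \<delta> u" "balanced_blocks l \<delta> v" "0 < l" "0 \<le> \<delta>" "length a \<le> 1"
    and "length (u @ a @ v) = n" "\<delta> * real n + real l + 1/2 \<le> \<epsilon> * real n"
  shows "balanced \<epsilon> (u @ a @ v)"
proof -
  have "\<bar>excess a\<bar> \<le> 1/2" using abs_excess_le[of a] assms(5) by linarith
  moreover have "\<delta> * real (length u) + \<delta> * real (length v) \<le> \<delta> * real n"
    using assms(4,6) by (auto simp: algebra_simps)
  ultimately have "\<bar>excess (u @ a @ v)\<bar> \<le> \<epsilon> * real n"
    using abs_excess_balanced_blocks[OF assms(1,3,4)] abs_excess_balanced_blocks[OF assms(2-4)]
      assms(7) by simp
  then show ?thesis unfolding balanced_iff_excess assms(6) .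
qed

lemma balanced_blocks_Nil: "0 < l \<Longrightarrow> balanced_blocks l \<delta> []"
  by (simp add: balanced_blocks_def)

lemma balanced_of_balanced_blocks:
  assumes "balanced_blocks l \<delta> u" "0 < l" "0 \<le> \<delta>" "length u = n"
    and "\<delta> * real n + real l + 1/2 \<le> \<epsilon> * real n"
  shows "balanced \<epsilon> u"
  using balanced_two_parts[OF assms(1) balanced_blocks_Nil[OF assms(2)] assms(2,3), of "[]"] assms(4,5)
  by simp

text \<open>Aligned blocks start at multiples of the period, so each complete one is
  \<open>w\<close> itself.\<close>

lemma balanced_blocks_periodic:
  assumes "balanced \<delta> w" "length w = l"
  shows "balanced_blocks l \<delta> (map (\<lambda>t. w ! (t mod l)) [0..<m])"
  unfolding balanced_blocks_def
proof (intro allI impI)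
  fix b assume "b * l + l \<le> length (map (\<lambda>t. w ! (t mod l)) [0..<m])"
  then have "take l (drop (b * l) (map (\<lambda>t. w ! (t mod l)) [0..<m])) = w"
    using assms(2) by (intro nth_equalityI) auto
  with assms(1) show "balanced \<delta> (take l (drop (b * l) (map (\<lambda>t. w ! (t mod l)) [0..<m])))"
    by simp
qed

subsection \<open>Strided subsequences\<close>

lemma length_strided [simp]: "length (strided d m p c) = m"
  by (simp add: strided_def)

lemma drop_strided: "drop a (strided d m p c) = strided d (m - a) (p + a * d) c"
  by (rule nth_equalityI) (simp_all add: strided_def less_diff_conv algebra_simps)

lemma take_strided: "take a (strided d m p c) = strided d (min a m) p c"
  by (rule nth_equalityI) (simp_all add: strided_def)

lemma take_drop_eq_strided: "p + m \<le> length c \<Longrightarrow> take m (drop p c) = strided 1 m p c"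
  by (rule nth_equalityI) (simp_all add: strided_def)

lemma balanced_strided:
  assumes "\<not> has_forbidden n l \<delta> c" "d = 1 \<or> d = n" "p + (l - 1) * d < length c"
  shows "balanced \<delta> (strided d l p c)"
  using assms by (auto simp: has_forbidden_def forbidden_at_def)

text \<open>Block \<open>b\<close> is again a segment of \<open>c\<close> of stride \<open>d\<close>
  and length \<open>l\<close>, starting at \<open>p + b * l * d\<close>, hence not forbidden. The
  guard \<open>m > 0\<close> keeps \<open>m - 1\<close> meaningful and lets the empty sequence start
  anywhere.\<close>

lemma balanced_blocks_strided:
  assumes "\<not> has_forbidden n l \<delta> c" "d = 1 \<or> d = n" "m > 0 \<Longrightarrow> p + (m - 1) * d < length c" "0 < l"
  shows "balanced_blocks l \<delta> (strided d m p c)"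
  unfolding balanced_blocks_def
proof (intro allI impI)
  fix b assume "b * l + l \<le> length (strided d m p c)"
  then have b: "b * l + l \<le> m" by simp
  \<comment> \<open>The last entry of block \<open>b\<close> comes no later than the last entry of
    the whole sequence.\<close>
  then have "(b * l + (l - 1)) * d \<le> (m - 1) * d"
    using \<open>0 < l\<close> by (intro mult_le_mono1) linarith
  then have "p + b * l * d + (l - 1) * d < length c"
    using assms(3,4) b unfolding add_mult_distrib by linarith
  from balanced_strided[OF assms(1,2) this]
  show "balanced \<delta> (take l (drop (b * l) (strided d m p c)))"
    using b by (simp add: drop_strided take_strided min_absorb1 le_diff_conv2)
qed

lemma suffix_of_length_strided:
  "l \<le> m \<Longrightarrow> suffix_of_length l (strided d m p c) = strided d l (p + (m - l) * d) c"
  by (simp add: suffix_of_length_def drop_strided)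

lemma suffix_of_length_eq_strided:
  "l \<le> length c \<Longrightarrow> suffix_of_length l c = strided 1 l (length c - l) c"
  using take_drop_eq_strided[of "length c - l" l c] by (simp add: suffix_of_length_def)

lemma length_suffix_of_length [simp]: "l \<le> length u \<Longrightarrow> length (suffix_of_length l u) = l"
  by (simp add: suffix_of_length_def)

lemma balanced_suffix:
  assumes "\<not> has_forbidden n l \<delta> c" "0 < l" "l \<le> length c"
  shows "balanced \<delta> (suffix_of_length l c)"
  unfolding suffix_of_length_eq_strided[OF assms(3)]
  using assms by (intro balanced_strided[of n l]) auto

subsection \<open>Arrays\<close>

lemma length_column [simp]: "length (column A j) = length A"
  by (simp add: column_def)

lemma column_append [simp]: "column (A @ B) j = column A j @ column B j"
  by (simp add: column_def)

lemma column_map_Not: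
  assumes "\<forall>r\<in>set A. length r = n" "j < n"
  shows "column (map (map Not) A) j = map Not (column A j)"
  using assms by (auto simp: column_def)

lemma Bal_RC_I:
  assumes "length A = n" "\<And>r. r \<in> set A \<Longrightarrow> length r = n" "\<And>r. r \<in> set A \<Longrightarrow> balanced \<epsilon> r"
    and "\<And>j. j < n \<Longrightarrow> balanced \<epsilon> (column A j)"
  shows "A \<in> Bal_RC n \<epsilon>"
  using assms by (auto simp: Bal_RC_def square_arrays_def)

lemma length_fill_rows [simp]: "length (fill_rows n c) = length c div n"
  by (simp add: fill_rows_def)

lemma fill_rows_nth:
  assumes "i < length c div n"
  shows "fill_rows n c ! i = strided 1 n (i * n) c" and "i * n + n \<le> length c"
proof -
  have "Suc i * n \<le> length c div n * n" using assms by (intro mult_le_mono1) simp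
  also have "\<dots> \<le> length c" by simp
  finally show le: "i * n + n \<le> length c" by simp
  show "fill_rows n c ! i = strided 1 n (i * n) c"
    using assms take_drop_eq_strided[OF le] by (simp add: fill_rows_def)
qed

lemma column_fill_rows:
  assumes "j < n"
  shows "column (fill_rows n c) j = strided n (length c div n) j c"
proof (rule nth_equalityI)
  fix i assume "i < length (column (fill_rows n c) j)"
  then show "column (fill_rows n c) j ! i = strided n (length c div n) j c ! i"
    using assms by (simp add: column_def fill_rows_nth(1)) (simp add: strided_def add.commute)
qed simp

lemma fill_rows_row:
  assumes "\<not> has_forbidden n l \<delta> c" "0 < l" "0 \<le> \<delta>" "r \<in> set (fill_rows n c)"
    and "\<delta> * real n + real l + 1/2 \<le> \<epsilon> * real n"
  shows "length r = n" "balanced \<epsilon> r"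
proof -
  obtain i where i: "i < length c div n" "r = strided 1 n (i * n) c"
    using assms(4) by (metis fill_rows_nth(1) in_set_conv_nth length_fill_rows)
  then show "length r = n" by simp
  have "balanced_blocks l \<delta> r"
    unfolding i(2) using fill_rows_nth(2)[OF i(1)] assms(1,2)
    by (intro balanced_blocks_strided) auto
  then show "balanced \<epsilon> r"
    using assms \<open>length r = n\<close> by (auto intro: balanced_of_balanced_blocks)
qed

lemma balanced_blocks_column_fill_rows:
  assumes "\<not> has_forbidden n l \<delta> c" "0 < l" "j < n"
  shows "balanced_blocks l \<delta> (column (fill_rows n c) j)"
  unfolding column_fill_rows[OF assms(3)]
proof (intro balanced_blocks_strided[OF assms(1)] disjI2 refl assms(2))
  assume "length c div n > 0"
  \<comment> \<open>The last complete row ends inside \<open>c\<close>, and the last entry of each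
    column lies in that row.\<close>
  then have "(length c div n - 1) * n + n = length c div n * n"
    by (cases "length c div n") simp_all
  also have "\<dots> \<le> length c" by simp
  finally show "j + (length c div n - 1) * n < length c" using assms(3) by linarith
qed

text \<open>This settles the case in which the encoder stops after the initial phase.\<close>

lemma fill_rows_Bal_RC:
  assumes "\<not> has_forbidden n l \<delta> c" "0 < l" "0 \<le> \<delta>" "length c = n\<^sup>2"
    and "\<delta> * real n + real l + 1/2 \<le> \<epsilon> * real n"
  shows "fill_rows n c \<in> Bal_RC n \<epsilon>"
proof (rule Bal_RC_I)
  show len: "length (fill_rows n c) = n"
    using assms(4) by (simp add: power2_eq_square)
  show "balanced \<epsilon> (column (fill_rows n c) j)" if "j < n" for j
    using balanced_of_balanced_blocks[OF balanced_blocks_column_fill_rows[OF assms(1,2) that]]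
      assms len by auto
qed (use fill_rows_row assms in blast)+

subsection \<open>Extension phase\<close>

text \<open>Eliminates the least number of copies \<open>j\<close>: a sufficiently long repetition
  of the suffix, once cut off, is a periodic word. If \<open>n\<close> divides the length of
  \<open>c\<close>, the last row is entirely periodic.\<close>

lemma row_extension_eq:
  assumes "0 < l" "l \<le> length c" "length c \<noteq> n div 2" "0 < n"
  shows "row_extension n l c = fill_rows n c @
    [drop (length c div n * n) c @
     map (\<lambda>t. suffix_of_length l c ! (t mod l)) [0..<n - length c mod n]]"
proof -
  define q where "q = length c div n"
  define w where "w = suffix_of_length l c"
  define j where "j = (LEAST j. length (c @ rep j w) > (q + 1) * n)"
  define v where "v = map (\<lambda>t. w ! (t mod l)) [0..<n - length c mod n]"
  have lw: "length w = l" using assms by (simp add: w_def)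
  \<comment> \<open>A crude number of copies suffices to show that the least one exists, since each
    copy has at least one bit.\<close>
  have "length (c @ rep (Suc ((q + 1) * n)) w) > (q + 1) * n"
  proof -
    have "(q + 1) * n < Suc ((q + 1) * n) * l"
      using \<open>0 < l\<close> by (metis Suc_leI lessI less_le_trans mult.right_neutral mult_le_mono2 One_nat_def)
    then show ?thesis by (simp add: lw)
  qed
  then have j: "length (c @ rep j w) > (q + 1) * n"
    unfolding j_def by (rule LeastI)
  have c: "length c = q * n + length c mod n" by (simp add: q_def)
  have r: "length c mod n < n" using \<open>0 < n\<close> by simp
  have "take (n - length c mod n) (rep j w) = v"
  proof (rule nth_equalityI)
    show "length (take (n - length c mod n) (rep j w)) = length v"
      using j c by (simp add: v_def)
    show "take (n - length c mod n) (rep j w) ! i = v ! i"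
      if "i < length (take (n - length c mod n) (rep j w))" for i
      using that by (simp add: v_def nth_rep lw)
  qed
  moreover have "(q + 1) * n - length c = n - length c mod n" using c r by simp
  moreover have "length c \<le> (q + 1) * n" using c r by simp
  ultimately have taken: "take ((q + 1) * n) (c @ rep j w) = c @ v" by simp
  have lcv: "length (c @ v) = (q + 1) * n" using c r by (simp add: v_def)
  \<comment> \<open>The first \<open>q\<close> rows lie inside \<open>c\<close>, so appending
    \<open>v\<close> leaves them unchanged.\<close>
  have full: "take n (drop (i * n) (c @ v)) = take n (drop (i * n) c)" if "i < q" for i
    using fill_rows_nth(2)[of i c n] that by (simp add: q_def)
  have last: "take n (drop (q * n) (c @ v)) = drop (q * n) c @ v"
    using c r by (simp add: v_def)
  have "fill_rows n (c @ v) = fill_rows n c @ [drop (q * n) c @ v]"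
  proof -
    have "length (c @ v) div n = Suc q" using lcv \<open>0 < n\<close> by simp
    then have "fill_rows n (c @ v) =
        map (\<lambda>i. take n (drop (i * n) (c @ v))) [0..<q] @ [take n (drop (q * n) (c @ v))]"
      unfolding fill_rows_def by (simp del: drop_append take_append)
    also have "map (\<lambda>i. take n (drop (i * n) (c @ v))) [0..<q] = fill_rows n c"
      unfolding fill_rows_def q_def[symmetric] using full by (intro map_cong) auto
    finally show ?thesis unfolding last .
  qed
  then show ?thesis
    using assms(3) taken
    by (simp add: row_extension_def Let_def q_def w_def j_def v_def)
qed

text \<open>Complete rows are segments of \<open>c\<close>. The last row consists of the tail of
  \<open>c\<close> and a periodic word built from a balanced suffix, so the two-part estimate
  applies with an empty middle.\<close>

lemma row_extension_row:
  assumes "\<not> has_forbidden n l \<delta> c" "0 < l" "0 \<le> \<delta>" "l \<le> length c" "length c \<noteq> n div 2" "0 < n"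
    and "\<delta> * real n + real l + 1/2 \<le> \<epsilon> * real n" "r \<in> set (row_extension n l c)"
  shows "length r = n \<and> balanced \<epsilon> r"
proof -
  define q where "q = length c div n"
  define v where "v = map (\<lambda>t. suffix_of_length l c ! (t mod l)) [0..<n - length c mod n]"
  have "balanced_blocks l \<delta> v"
    unfolding v_def using assms by (intro balanced_blocks_periodic balanced_suffix) auto
  moreover have "balanced_blocks l \<delta> (drop (q * n) c)"
  proof -
    have eq: "drop (q * n) c = strided 1 (length c - q * n) (q * n) c"
      using take_drop_eq_strided[of "q * n" "length c - q * n" c] by (simp add: q_def)
    show ?thesis
      unfolding eq using assms(1,2) by (intro balanced_blocks_strided) auto
  qed
  moreover have len: "length (drop (q * n) c @ v) = n"
  proof -
    have "length c - q * n = length c mod n" by (simp add: q_def minus_div_mult_eq_mod)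
    moreover have "length c mod n < n" using \<open>0 < n\<close> by simp
    ultimately show ?thesis by (simp add: v_def)
  qed
  ultimately have "balanced \<epsilon> (drop (q * n) c @ v)"
    using balanced_two_parts[of l \<delta> "drop (q * n) c" v "[]" n \<epsilon>] assms by simp
  with len show ?thesis
    using assms(8) fill_rows_row[OF assms(1-3) _ assms(7)]
    unfolding row_extension_eq[OF assms(2,4-6)] q_def v_def by auto
qed

text \<open>Each column of \<open>B\<close> cancels against its complement, and the alternating rows
  add zero excess, so all columns are exactly balanced. Rows inherit balance from \<open>B\<close>,
  as complementing only flips the sign of the excess.\<close>

lemma array_extension_complement:
  assumes "length B = q + 1" "q + 1 \<le> n div 2" "even n" "0 < n" "0 \<le> \<epsilon>"
    and rows: "\<And>r. r \<in> set B \<Longrightarrow> length r = n \<and> balanced \<epsilon> r"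
  shows "array_extension n l q B \<in> Bal_RC n \<epsilon>"
proof -
  define D where "D = map (\<lambda>t. if even t then rep (n div 2) [False, True]
    else rep (n div 2) [True, False]) [0..<n - 2 * (q + 1)]"
  have "q + 1 \<noteq> n" using assms(2,4) by linarith
  then have eq: "array_extension n l q B = B @ map (map Not) B @ D"
    using assms(2) by (simp add: array_extension_def D_def)
  have D: "length r = n \<and> balanced \<epsilon> r" if "r \<in> set D" for r
    using that \<open>even n\<close> \<open>0 \<le> \<epsilon>\<close>
    by (auto simp: D_def balanced_iff_excess excess_Cons)
  show ?thesis
    unfolding eq
  proof (rule Bal_RC_I)
    show "length (B @ map (map Not) B @ D) = n"
      using assms(1,2) by (simp add: D_def)
    show "length r = n" "balanced \<epsilon> r" if "r \<in> set (B @ map (map Not) B @ D)" for r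
      using that rows D by (auto simp: balanced_iff_excess) (metis rows balanced_iff_excess)
    fix j assume j: "j < n"
    \<comment> \<open>As \<open>n\<close> is even, the number of alternating rows is even and the
      pattern closes up.\<close>
    have "n - 2 * (q + 1) = 2 * (n div 2 - (q + 1))" using \<open>even n\<close> by auto
    then have "column D j = map (\<lambda>t. even t \<noteq> even j) [0..<2 * (n div 2 - (q + 1))]"
      using j \<open>even n\<close> unfolding D_def column_def
      by (auto simp: nth_rep numeral_2_eq_2[symmetric] mod_2_eq_odd)
    then have "excess (column D j) = 0" by (simp only: excess_alternating)
    moreover have "column (map (map Not) B) j = map Not (column B j)"
      using rows j by (intro column_map_Not) auto
    ultimately show "balanced \<epsilon> (column (B @ map (map Not) B @ D) j)"
      using \<open>0 \<le> \<epsilon>\<close> by (simp add: balanced_iff_excess)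
  qed
qed

text \<open>Each column splits into its first \<open>q\<close> bits, the bit of row
  \<open>q + 1\<close>, and a periodic word, to which the two-part estimate applies. The appended
  rows repeat the last \<open>l\<close> complete rows cyclically.\<close>

lemma column_extension_Bal_RC:
  assumes "\<not> has_forbidden n l \<delta> c" "0 < l" "0 \<le> \<delta>" "q < n" "l \<le> q" "q = length c div n"
    and rows: "\<And>r. r \<in> set (fill_rows n c @ [e]) \<Longrightarrow> length r = n \<and> balanced \<epsilon> r"
    and slack: "\<delta> * real n + real l + 1/2 \<le> \<epsilon> * real n"
  shows "column_extension n l q (fill_rows n c @ [e]) \<in> Bal_RC n \<epsilon>"
proof -
  define B where "B = fill_rows n c @ [e]"
  define w where "w = (\<lambda>i. suffix_of_length l (take q (column B i)))"
  define D where "D = map (\<lambda>t. map (\<lambda>i. w i ! (t mod l)) [0..<n]) [0..<n - (q + 1)]"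
  have w: "w i = strided n l (i + (q - l) * n) c" if "i < n" for i
    using that \<open>l \<le> q\<close>
    by (simp add: w_def B_def column_fill_rows assms(6)[symmetric] suffix_of_length_strided take_strided)
  have D: "length r = n \<and> balanced \<epsilon> r" if r: "r \<in> set D" for r
  proof -
    obtain t where t: "r = map (\<lambda>i. w i ! (t mod l)) [0..<n]"
      using r by (auto simp: D_def)
    have tl: "t mod l < l" using \<open>0 < l\<close> by simp
    then have i: "q - l + t mod l < length c div n" using \<open>l \<le> q\<close> assms(6) by linarith
    \<comment> \<open>Entry \<open>t mod l\<close> of every suffix \<open>w i\<close> sits in the
      same row of the array, so the appended row is a copy of that row.\<close>
    have "r = fill_rows n c ! (q - l + t mod l)"
      unfolding fill_rows_nth(1)[OF i] t using tl
      by (intro nth_equalityI) (simp_all add: w, simp add: strided_def algebra_simps)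
    then have "r \<in> set (fill_rows n c)" using i by simp
    then show ?thesis using rows by simp
  qed
  show ?thesis
    unfolding column_extension_def Let_def B_def[symmetric] w_def[symmetric] D_def[symmetric]
  proof (rule Bal_RC_I)
    show len: "length (B @ D) = n" using \<open>q < n\<close> assms(6) by (simp add: B_def D_def)
    show "length r = n" "balanced \<epsilon> r" if "r \<in> set (B @ D)" for r
      using that rows D by (auto simp: B_def)
    fix j assume j: "j < n"
    have colD: "column D j = map (\<lambda>t. w j ! (t mod l)) [0..<n - (q + 1)]"
      using j by (simp add: column_def D_def)
    have "balanced \<delta> (w j)"
    proof -
      \<comment> \<open>The suffix ends in the last complete row and therefore lies inside
        \<open>c\<close>. Row \<open>q + 1\<close> may contain bits beyond the end of
        \<open>c\<close>, hence its omission.\<close>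
      have "(q - l + (l - 1)) * n + n = q * n"
        using \<open>l \<le> q\<close> \<open>0 < l\<close> by (simp flip: mult_Suc add: add.commute[of _ n])
      also have "\<dots> \<le> length c" by (simp add: assms(6))
      finally have "j + (q - l) * n + (l - 1) * n < length c"
        using j by (simp add: algebra_simps)
      then show ?thesis unfolding w[OF j] by (intro balanced_strided[OF assms(1)]) auto
    qed
    then have "balanced_blocks l \<delta> (column D j)"
      unfolding colD by (rule balanced_blocks_periodic) (simp add: w[OF j])
    moreover have "balanced_blocks l \<delta> (column (fill_rows n c) j)"
      by (rule balanced_blocks_column_fill_rows[OF assms(1,2) j])
    moreover have "length (column (fill_rows n c) j @ column [e] j @ column D j) = n"
      using len by (simp add: B_def)
    ultimately show "balanced \<epsilon> (column (B @ D) j)"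
      using balanced_two_parts[of l \<delta> "column (fill_rows n c) j" "column D j" "column [e] j" n \<epsilon>]
        assms(2,3) slack
      unfolding B_def column_append append_assoc by simp
  qed
qed

text \<open>The length bounds give \<open>l \<le> length c\<close> and \<open>q < n\<close>. If the
  complement construction does not fit, then \<open>q \<ge> n div 2 > l\<close>, so every column has
  a suffix of length \<open>l\<close>.\<close>

lemma extension_phase_Bal_RC:
  assumes "\<not> has_forbidden n l \<delta> c" "0 < l" "0 \<le> \<delta>" "0 \<le> \<epsilon>" "even n" "l < n div 2"
    and "n div 2 < length c" "length c < n\<^sup>2"
    and slack: "\<delta> * real n + real l + 1/2 \<le> \<epsilon> * real n"
  shows "extension_phase n l c \<in> Bal_RC n \<epsilon>"
proof -
  define q where "q = length c div n"
  have n: "0 < n" using assms(6) by linarith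
  have q: "q < n" using assms(8) by (simp add: q_def less_mult_imp_div_less power2_eq_square)
  obtain e where B: "row_extension n l c = fill_rows n c @ [e]"
    using row_extension_eq[of l c n] assms n by auto
  have rows: "length r = n \<and> balanced \<epsilon> r" if "r \<in> set (fill_rows n c @ [e])" for r
    using row_extension_row[of n l \<delta> c \<epsilon> r] assms n that unfolding B by auto
  show ?thesis
  proof (cases "q + 1 \<le> n div 2")
    case True
    then show ?thesis
      unfolding extension_phase_def B q_def[symmetric]
      using assms n rows by (intro array_extension_complement) (auto simp: q_def)
  next
    case False
    have "column_extension n l q (fill_rows n c @ [e]) \<in> Bal_RC n \<epsilon>"
      using assms q False rows q_def by (intro column_extension_Bal_RC[of n l \<delta>]) auto
    \<comment> \<open>For \<open>q + 1 = n\<close> the column extension appends no rows, so this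
      case is covered as well.\<close>
    moreover have "array_extension n l q (fill_rows n c @ [e]) =
        column_extension n l q (fill_rows n c @ [e])"
      using False by (auto simp: array_extension_def column_extension_def)
    ultimately show ?thesis
      unfolding extension_phase_def B q_def[symmetric] by simp
  qed
qed

text \<open>At this length the loop may stop with forbidden subsequences left. The single row is a
  word followed by its complement, so its excess vanishes, and the complement construction completes
  the array.\<close>

lemma extension_phase_half_row:
  assumes "length c = n div 2" "even n" "0 < n" "0 \<le> \<epsilon>"
  shows "extension_phase n l c \<in> Bal_RC n \<epsilon>"
proof -
  have "length c div n = 0" using assms by simp
  then show ?thesis
    unfolding extension_phase_def row_extension_def
    using assms
    by (simp, intro array_extension_complement) (auto simp: balanced_iff_excess elim!: evenE)
qed

subsection \<open>Replacement phase\<close>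

text \<open>Each step removes exactly one bit, so the length cannot jump past
  \<open>n div 2\<close>. The strict upper bound later yields \<open>q < n\<close> in the extension
  phase.\<close>

lemma replacement_phase_result:
  assumes "has_forbidden n l \<delta> c" "n div 2 < length c" "0 < n"
    and k: "l = k + 3 + pos_bits n"
    and \<Psi>: "\<Psi> ` unbalanced l \<delta> \<subseteq> {u. length u = k}"
  defines "c' \<equiv> replacement_phase n l \<delta> \<Psi> c"
  shows "n div 2 \<le> length c'" "length c' < length c"
    and "\<not> has_forbidden n l \<delta> c' \<or> length c' = n div 2"
proof -
  let ?b = "\<lambda>c. has_forbidden n l \<delta> c \<and> length c \<noteq> n div 2"
  let ?f = "replace_step n l \<delta> \<Psi>"
  have step: "length (?f d) = length d - 1" if "has_forbidden n l \<delta> d" for d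
    using length_replace_step[OF that \<open>0 < n\<close> k \<Psi>] .
  \<comment> \<open>The loop is unrolled once because the strict bound in the invariant holds only
    from the first replacement on.\<close>
  have "c' = while ?b ?f (?f c)"
    unfolding c'_def replacement_phase_def using assms(1,2) by (subst while_unfold) simp
  moreover have "(n div 2 \<le> length (while ?b ?f (?f c)) \<and>
      length (while ?b ?f (?f c)) < length c) \<and> \<not> ?b (while ?b ?f (?f c))"
  proof (rule while_rule[where P = "\<lambda>d. n div 2 \<le> length d \<and> length d < length c"
        and r = "measure length"])
    show "n div 2 \<le> length (?f c) \<and> length (?f c) < length c"
      using step[OF assms(1)] assms(2) by linarith
    show "n div 2 \<le> length (?f d) \<and> length (?f d) < length c"
      if "n div 2 \<le> length d \<and> length d < length c" "?b d" for d
      using step[of d] that by linarith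
    show "(?f d, d) \<in> measure length"
      if "n div 2 \<le> length d \<and> length d < length c" "?b d" for d
      using step[of d] that by auto
  qed auto
  ultimately show "n div 2 \<le> length c'" "length c' < length c"
    "\<not> has_forbidden n l \<delta> c' \<or> length c' = n div 2" by auto
qed

text \<open>Correctness for fixed \<open>n\<close>: the requirement that \<open>n\<close> be large
  enters only through \<open>slack\<close>, which lets the gap between \<delta> and \<epsilon>
  absorb the leftovers.\<close>

lemma Enc_Bal_RC:
  assumes "0 < l" "0 \<le> \<delta>" "0 \<le> \<epsilon>" "even n" "l < n div 2"
    and k: "l = k + 3 + pos_bits n"
    and \<Psi>: "\<Psi> ` unbalanced l \<delta> \<subseteq> {u. length u = k}"
    and x: "length x = n\<^sup>2 - 1"
    and slack: "\<delta> * real n + real l + 1/2 \<le> \<epsilon> * real n"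
  shows "Enc n l \<delta> \<Psi> x \<in> Bal_RC n \<epsilon>"
proof -
  define c where "c = False # x"
  have n: "0 < n" using assms(5) by linarith
  have c: "length c = n\<^sup>2" using x n by (simp add: c_def)
  have "n div 2 < n" using n by simp
  also have "n \<le> n\<^sup>2" by (simp add: power2_nat_le_imp_le power2_eq_square)
  finally have half: "n div 2 < length c" by (simp add: c)
  show ?thesis
  proof (cases "has_forbidden n l \<delta> c")
    case False
    then show ?thesis
      using fill_rows_Bal_RC[OF False assms(1,2) c slack] by (simp add: Enc_def c_def)
  next
    case True
    define c' where "c' = replacement_phase n l \<delta> \<Psi> c"
    note res = replacement_phase_result[OF True half n k \<Psi>, folded c'_def]
    have "extension_phase n l c' \<in> Bal_RC n \<epsilon>"
    proof (cases "length c' = n div 2")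
      case True
      then show ?thesis using assms n by (intro extension_phase_half_row)
    next
      case False
      then show ?thesis
        using res c assms by (intro extension_phase_Bal_RC[of n l \<delta>]) auto
    qed
    then show ?thesis using True by (simp add: Enc_def c_def c'_def Let_def)
  qed
qed

section \<open>Arithmetic of the parameters for large \<open>n\<close>\<close>

lemma even_of_log2_int:
  assumes "log 2 (real n) \<in> \<int>" "2 \<le> n"
  shows "even n"
proof -
  obtain z where z: "log 2 (real n) = of_int z" using assms(1) by (auto elim: Ints_cases)
  \<comment> \<open>An integral logarithm makes \<open>n\<close> a power of two; a positive exponent
    makes it even.\<close>
  have "log 2 (real n) \<ge> 1" using assms(2) by (simp add: le_log_iff)
  then have "z \<ge> 1" using z by simp
  have "real n = 2 powr (of_int z)" using z assms(2) by (metis less_le_trans log_powr_cancel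
    of_nat_0_less_iff powr_log_cancel zero_less_numeral numeral_eq_one_iff semiring_norm(85))
  also have "of_int z = real (nat z)" using \<open>z \<ge> 1\<close> by simp
  finally have "real n = real (2 ^ nat z)" by (simp add: powr_realpow)
  then have "n = 2 ^ nat z" by (simp only: of_nat_eq_iff)
  then show ?thesis using \<open>z \<ge> 1\<close> by simp
qed

theorem theorem6:
  fixes \<epsilon> \<alpha> :: real
  assumes "0 < \<epsilon>" "\<epsilon> < 1/2" "\<alpha> \<ge> 1 / (\<epsilon>/2)\<^sup>2"
  shows "\<forall>\<^sub>F n in sequentially.
    \<forall>(l :: nat) (k :: nat) (\<Psi> :: bool list \<Rightarrow> bool list) (x :: bool list).
      l = nat \<lceil>\<alpha> * ln (real (n\<^sup>2))\<rceil> \<longrightarrow>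
      real k = real l - 3 - 2 * log 2 (real n) \<longrightarrow>
      log 2 (real n) \<in> \<int> \<longrightarrow>
      (\<exists>s. n = l * s) \<longrightarrow>
      real n * \<epsilon> \<ge> 2 \<longrightarrow>
      (real n)\<^sup>2 \<ge> (8 / \<epsilon>\<^sup>2) * ln (real n) \<longrightarrow>
      real l < real n / 2 \<longrightarrow>
      \<Psi> ` unbalanced l (\<epsilon>/2) \<subseteq> {u. length u = k} \<longrightarrow>
      inj_on \<Psi> (unbalanced l (\<epsilon>/2)) \<longrightarrow>
      length x = n\<^sup>2 - 1 \<longrightarrow>
      Enc n l (\<epsilon>/2) \<Psi> x \<in> Bal_RC n \<epsilon>"
proof -
  have "0 < 1 / (\<epsilon>/2)\<^sup>2" using assms(1) by simp
  then have \<alpha>: "0 < \<alpha>" using assms(3) by linarith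
  \<comment> \<open>Rounding up gives \<open>l \<le> \<alpha> * ln (n\<^sup>2) + 1\<close>, so this
    is twice the required \<open>l + 1/2 \<le> \<epsilon>/2 * n\<close>. It holds eventually because
    the left side is logarithmic.\<close>
  have "\<forall>\<^sub>F n in sequentially. 2 * (\<alpha> * ln (real (n\<^sup>2)) + 1) + 1 \<le> \<epsilon> * real n"
    using assms(1) \<alpha> by real_asymp
  then show ?thesis
    using eventually_ge_at_top[of 2]
  proof eventually_elim
    case (elim n)
    show ?case
    proof (intro allI impI)
      fix l k :: nat and \<Psi> :: "bool list \<Rightarrow> bool list" and x :: "bool list"
      assume l: "l = nat \<lceil>\<alpha> * ln (real (n\<^sup>2))\<rceil>"
        and k: "real k = real l - 3 - 2 * log 2 (real n)"
        and int: "log 2 (real n) \<in> \<int>"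
        and s: "\<exists>s. n = l * s"
        and half: "real l < real n / 2"
        and \<Psi>: "\<Psi> ` unbalanced l (\<epsilon>/2) \<subseteq> {u. length u = k}"
        and x: "length x = n\<^sup>2 - 1"
      have "even n" using even_of_log2_int int elim(2) by blast
      have "0 < l" using s elim(2) by (cases "l = 0") auto
      have "l < n div 2" using half \<open>even n\<close> by (auto elim!: evenE)
      have "l = k + 3 + pos_bits n"
      proof -
        have "0 \<le> log 2 (real n)" using elim(2) by simp
        then have le: "real (k + 3) \<le> real l" using k by simp
        \<comment> \<open>This value is a natural number, so the floor in \<open>pos_bits\<close> is
          exact.\<close>
        then have "2 * log 2 (real n) = real (l - (k + 3))" using k by (simp add: of_nat_diff)
        then have "pos_bits n = l - (k + 3)" by (simp add: pos_bits_def)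
        with le show ?thesis by simp
      qed
      have "0 \<le> \<alpha> * ln (real (n\<^sup>2))" using \<alpha> elim(2) by simp
      then have "real l \<le> \<alpha> * ln (real (n\<^sup>2)) + 1" unfolding l by linarith
      then have "\<epsilon>/2 * real n + real l + 1/2 \<le> \<epsilon> * real n" using elim(1) by simp
      then show "Enc n l (\<epsilon>/2) \<Psi> x \<in> Bal_RC n \<epsilon>"
        using Enc_Bal_RC[of l "\<epsilon>/2" \<epsilon> n k \<Psi> x] assms(1) \<open>even n\<close> \<open>0 < l\<close> \<open>l < n div 2\<close>
          \<open>l = k + 3 + pos_bits n\<close> \<Psi> x by simp
    qed
  qed
qed

end
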